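(* Let $S\subset\mathbb{R}^n$ be a simplex with affinely independent vertices $p_0,\dots,p_n\in\mathbb{R}^n$ and barycenter $\overline{p}=\frac{1}{n+1}\sum_{i=0}^n p_i$. Let $\mathcal{T}$ be a positive linear functional defined on $\mathcal{C}^2(S)$ such that $\mathcal{T}(p)=\int_S p(x)\,dx$ for all polynomials $p:\mathbb{R}^n\to\mathbb{R}$ of degree at most $2$ (restricted to $S$). Then $$\left|\int_S f(x)\,dx-\mathcal{T}(f)\right|\leq\|d^2f\|_{\infty}\int_S\|x-\overline{p}\|^2\,dx$$ for any $f\in\mathcal{C}^2(S)$.
   Context: A linear functional $\mathcal{T}$ defined on a linear space $X$ of real-valued functions on a nonempty set is called positive if, for any $f,g\in X$, $f\leq g$ (pointwise) implies $\mathcal{T}(f)\leq\mathcal{T}(g)$. $\|x\|$ denotes the Euclidean norm on $\mathbb{R}^n$. $\mathcal{C}^2(S)$ is the space of twice continuously differentiable real-valued functions on $S$ (continuous on $S$, twice continuously differentiable in the interior, with all partial derivatives of order at most two extending continuously to $S$; derivatives at boundary points are these extensions). For a quadratic form $\varphi:\mathbb{R}^n\to\mathbb{R}$ put $\|\varphi\|:=\sup\{|\varphi(x)|:\|x\|=1\}$. For $f\in\mathcal{C}^2(S)$ and $u\in S$, $d^2f(u)$ is the quadratic form $v\mapsto d^2f(u)(v,v)=\sum_{i,j=1}^n\frac{\partial^2f}{\partial x_i\partial x_j}(u)v_iv_j$, and $\|d^2f\|_{\infty}:=\sup_{u\in S}\|d^2f(u)\|$ (which is finite). *)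

theory Defs
  imports "HOL-Analysis.Analysis"
begin

definition partial_deriv :: "'n \<Rightarrow> (real^'n::finite \<Rightarrow> real) \<Rightarrow> real^'n \<Rightarrow> real" where
  "partial_deriv i f u = frechet_derivative f (at u) (axis i 1)"

definition extends_cont :: "(real^'n::finite) set \<Rightarrow> (real^'n \<Rightarrow> real) \<Rightarrow> bool" where
  "extends_cont S h \<longleftrightarrow> (\<exists>g. continuous_on S g \<and> (\<forall>u\<in>interior S. g u = h u))"

text \<open>
  Functions on \<open>S\<close> are represented by total functions whose values outside \<open>S\<close> are irrelevant:
  derivatives are taken at interior points only. Continuity of the partial derivatives in
  the interior is part of their having continuous extensions to \<open>S\<close>.
\<close>
definition C2_on :: "(real^'n::finite) set \<Rightarrow> (real^'n \<Rightarrow> real) set" where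
  "C2_on S = {f. continuous_on S f \<and>
     f differentiable_on interior S \<and>
     (\<forall>j. partial_deriv j f differentiable_on interior S) \<and>
     (\<forall>j. extends_cont S (partial_deriv j f)) \<and>
     (\<forall>i j. extends_cont S (partial_deriv i (partial_deriv j f)))}"

text \<open>
  The limit is the value at \<open>u\<close> of the continuous extension; it is unique when \<open>u\<close> lies in the
  closure of the interior of \<open>S\<close>, and for interior \<open>u\<close> it is the second partial derivative itself.
\<close>
definition partial_deriv2 ::
    "(real^'n::finite) set \<Rightarrow> 'n \<Rightarrow> 'n \<Rightarrow> (real^'n \<Rightarrow> real) \<Rightarrow> real^'n \<Rightarrow> real" where
  "partial_deriv2 S i j f u =
     Lim (at u within interior S) (partial_deriv i (partial_deriv j f))"

definition d2 :: "(real^'n::finite) set \<Rightarrow> (real^'n \<Rightarrow> real) \<Rightarrow> real^'n \<Rightarrow> real^'n \<Rightarrow> real" where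
  "d2 S f u v = (\<Sum>i\<in>UNIV. \<Sum>j\<in>UNIV. partial_deriv2 S i j f u * v $ i * v $ j)"

definition quad_form_norm :: "(real^'n::finite \<Rightarrow> real) \<Rightarrow> real" where
  "quad_form_norm \<phi> = (SUP x\<in>{x. norm x = 1}. \<bar>\<phi> x\<bar>)"

definition d2_sup_norm :: "(real^'n::finite) set \<Rightarrow> (real^'n \<Rightarrow> real) \<Rightarrow> real" where
  "d2_sup_norm S f = (SUP u\<in>S. quad_form_norm (d2 S f u))"

text \<open>Sum over the (finitely many) multi-indices \<open>\<alpha>\<close> with \<open>|\<alpha>| \<le> d\<close>.\<close>
definition polys_deg_le :: "nat \<Rightarrow> (real^'n::finite \<Rightarrow> real) set" where
  "polys_deg_le d = {q. \<exists>c :: ('n \<Rightarrow> nat) \<Rightarrow> real. \<forall>x.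
     q x = (\<Sum>\<alpha> | (\<Sum>i\<in>UNIV. \<alpha> i) \<le> d. c \<alpha> * (\<Prod>i\<in>UNIV. (x $ i) ^ \<alpha> i))}"

text \<open>
  \<open>X\<close> is a linear space of functions on \<open>S\<close>, represented by total functions. Positivity forces
  \<open>T f = T g\<close> whenever \<open>f\<close> and \<open>g\<close> in \<open>X\<close> agree on \<open>S\<close>, so \<open>T\<close> is well defined on restrictions to \<open>S\<close>.
\<close>
definition positive_linear_functional ::
    "'a set \<Rightarrow> ('a \<Rightarrow> real) set \<Rightarrow> (('a \<Rightarrow> real) \<Rightarrow> real) \<Rightarrow> bool" where
  "positive_linear_functional S X T \<longleftrightarrow>
     (\<forall>f\<in>X. \<forall>g\<in>X. T (\<lambda>x. f x + g x) = T f + T g) \<and>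
     (\<forall>c. \<forall>f\<in>X. T (\<lambda>x. c * f x) = c * T f) \<and>
     (\<forall>f\<in>X. \<forall>g\<in>X. (\<forall>x\<in>S. f x \<le> g x) \<longrightarrow> T f \<le> T g)"

end

theory Submission imports Defs begin

text \<open>
  With \<open>M\<close> the norm of \<open>d\<^sup>2f\<close> and \<open>q x = \<parallel>x - pbar\<parallel>\<^sup>2\<close>, Taylor's formula at the interior point \<open>pbar\<close>
  gives \<open>L - M/2 q \<le> f \<le> L + M/2 q\<close> on \<open>S\<close> for the affine function \<open>L\<close> tangent to \<open>f\<close> at \<open>pbar\<close>.
  On the two quadratic bounds \<open>T\<close> agrees with the integral, so by positivity \<open>T f\<close> and
  the integral of \<open>f\<close> both lie in an interval of length \<open>M \<integral> q\<close>.
\<close>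

subsection \<open>Partial derivatives\<close>

lemma partial_deriv_eqI:
  assumes "(f has_derivative f') (at u)"
  shows "partial_deriv i f u = f' (axis i 1)"
  unfolding partial_deriv_def using frechet_derivative_at[OF assms] by simp

text \<open>Chain rule, with the direction \<open>v\<close> expanded in the standard basis. It
  serves twice on a segment: for \<open>f\<close> itself and for each of its partial
  derivatives.\<close>

lemma DERIV_along_line:
  assumes "g differentiable at (w + t *\<^sub>R v)"
  shows "((\<lambda>t. g (w + t *\<^sub>R v)) has_real_derivative
    (\<Sum>i\<in>UNIV. partial_deriv i g (w + t *\<^sub>R v) * v $ i)) (at t)"
proof -
  let ?D = "frechet_derivative g (at (w + t *\<^sub>R v))"
  have D: "(g has_derivative ?D) (at (w + t *\<^sub>R v))"
    using assms by (simp add: frechet_derivative_works)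
  interpret linear ?D
    using D by (rule has_derivative_linear)
  have "((\<lambda>t. w + t *\<^sub>R v) has_derivative (\<lambda>h. h *\<^sub>R v)) (at t)"
    by (auto intro!: derivative_eq_intros)
  from diff_chain_at[OF this D]
  have "((\<lambda>t. g (w + t *\<^sub>R v)) has_derivative (\<lambda>h. h * ?D v)) (at t)"
    by (simp add: o_def scaleR)
  moreover have "?D v = (\<Sum>i\<in>UNIV. partial_deriv i g (w + t *\<^sub>R v) * v $ i)"
    by (subst basis_expansion[of v, symmetric])
       (simp add: sum scaleR partial_deriv_def scalar_mult_eq_scaleR mult.commute del: basis_expansion)
  ultimately show ?thesis
    by (simp add: has_field_derivative_def mult.commute[of _ "?D v"] mult_commute_abs)
qed

subsection \<open>Polynomials of bounded degree\<close>

text \<open>Each entry is at most the total degree. Finiteness matters because a sum over an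
  infinite index set would be 0 by convention.\<close>

lemma finite_multi_indices: "finite {\<alpha> :: 'n::finite \<Rightarrow> nat. (\<Sum>i\<in>UNIV. \<alpha> i) \<le> d}"
proof (rule finite_subset)
  show "{\<alpha> :: 'n \<Rightarrow> nat. (\<Sum>i\<in>UNIV. \<alpha> i) \<le> d} \<subseteq> (UNIV \<rightarrow>\<^sub>E {..d})"
    by (auto simp: PiE_iff intro: order_trans[OF member_le_sum[of _ UNIV]])
qed (simp add: finite_PiE)

lemma polys_deg_le_monomial:
  fixes \<alpha> :: "'n::finite \<Rightarrow> nat"
  assumes "(\<Sum>i\<in>UNIV. \<alpha> i) \<le> d"
  shows "(\<lambda>x :: real^'n. \<Prod>i\<in>UNIV. (x $ i) ^ \<alpha> i) \<in> polys_deg_le d"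
  unfolding polys_deg_le_def mem_Collect_eq
  using assms
  by (intro exI[of _ "\<lambda>\<beta>. if \<beta> = \<alpha> then 1 else 0"])
     (simp add: if_distrib[of "\<lambda>c. c * _"] sum.delta[OF finite_multi_indices] cong: if_cong)

lemma polys_deg_le_one: "(\<lambda>x :: real^'n::finite. 1) \<in> polys_deg_le d"
  using polys_deg_le_monomial[of "\<lambda>_. 0"] by simp

text \<open>Powers of single coordinates suffice as building blocks later on, since the squared
  Euclidean norm has no mixed terms.\<close>

lemma polys_deg_le_coord:
  assumes "k \<le> d"
  shows "(\<lambda>x :: real^'n::finite. (x $ i) ^ k) \<in> polys_deg_le d"
proof -
  have "(\<Prod>j\<in>UNIV. (x $ j) ^ (if j = i then k else 0)) = (x $ i) ^ k" for x :: "real^'n"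
    by (simp add: if_distrib[of "power _"] prod.delta cong: if_cong)
  then show ?thesis
    using polys_deg_le_monomial[of "\<lambda>j. if j = i then k else 0" d] assms by simp
qed

lemma polys_deg_le_cmult:
  assumes "q \<in> polys_deg_le d"
  shows "(\<lambda>x :: real^'n::finite. a * q x) \<in> polys_deg_le d"
proof -
  obtain c where "\<forall>x. q x = (\<Sum>\<alpha> | (\<Sum>i\<in>UNIV. \<alpha> i) \<le> d. c \<alpha> * (\<Prod>i\<in>UNIV. (x $ i) ^ \<alpha> i))"
    using assms unfolding polys_deg_le_def by blast
  then show ?thesis
    unfolding polys_deg_le_def mem_Collect_eq
    by (intro exI[of _ "\<lambda>\<alpha>. a * c \<alpha>"]) (simp add: sum_distrib_left mult.assoc)
qed

lemma polys_deg_le_add: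
  assumes "q \<in> polys_deg_le d" "r \<in> polys_deg_le d"
  shows "(\<lambda>x :: real^'n::finite. q x + r x) \<in> polys_deg_le d"
proof -
  obtain c c' where
    "\<forall>x. q x = (\<Sum>\<alpha> | (\<Sum>i\<in>UNIV. \<alpha> i) \<le> d. c \<alpha> * (\<Prod>i\<in>UNIV. (x $ i) ^ \<alpha> i))"
    "\<forall>x. r x = (\<Sum>\<alpha> | (\<Sum>i\<in>UNIV. \<alpha> i) \<le> d. c' \<alpha> * (\<Prod>i\<in>UNIV. (x $ i) ^ \<alpha> i))"
    using assms unfolding polys_deg_le_def by blast
  then show ?thesis
    unfolding polys_deg_le_def mem_Collect_eq
    by (intro exI[of _ "\<lambda>\<alpha>. c \<alpha> + c' \<alpha>"]) (simp add: sum.distrib distrib_right)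
qed

lemma polys_deg_le_sum:
  fixes q :: "'i \<Rightarrow> real^'n::finite \<Rightarrow> real"
  assumes "finite I" "\<And>i. i \<in> I \<Longrightarrow> q i \<in> polys_deg_le d"
  shows "(\<lambda>x. \<Sum>i\<in>I. q i x) \<in> polys_deg_le d"
  using assms
proof (induction I rule: finite_induct)
  case empty
  then show ?case
    using polys_deg_le_cmult[OF polys_deg_le_one, of 0] by simp
qed (simp add: polys_deg_le_add)

subsection \<open>Centred quadratic functions\<close>

text \<open>Taylor's affine part at \<open>w\<close> plus a multiple of the squared distance;
  opposite signs of \<open>c\<close> give the upper and the lower bound for
  \<open>f\<close>.\<close>

definition centred_quadratic ::
    "real^'n::finite \<Rightarrow> real \<Rightarrow> real^'n \<Rightarrow> real \<Rightarrow> real^'n \<Rightarrow> real" where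
  "centred_quadratic w a b c x = a + b \<bullet> (x - w) + c * (norm (x - w))\<^sup>2"

lemma centred_quadratic_in_polys_deg_le: "centred_quadratic w a b c \<in> polys_deg_le 2"
proof -
  have "centred_quadratic w a b c = (\<lambda>x. (a - b \<bullet> w + c * (norm w)\<^sup>2) * 1
      + (\<Sum>i\<in>UNIV. (b $ i - 2 * c * w $ i) * (x $ i) ^ 1 + c * (x $ i) ^ 2))"
    unfolding centred_quadratic_def power2_norm_eq_inner inner_vec_def
    by (rule ext) (simp add: sum.distrib sum_subtractf sum_distrib_left power2_eq_square algebra_simps)
  also have "\<dots> \<in> polys_deg_le 2"
    by (intro polys_deg_le_add polys_deg_le_sum polys_deg_le_cmult polys_deg_le_one
        polys_deg_le_coord) auto
  finally show ?thesis .
qed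

lemma centred_quadratic_has_derivative:
  "(centred_quadratic w a b c has_derivative (\<lambda>h. (b + (2 * c) *\<^sub>R (x - w)) \<bullet> h)) (at x within A)"
  unfolding centred_quadratic_def power2_norm_eq_inner
  by (auto intro!: derivative_eq_intros simp: inner_add_left inner_commute algebra_simps)

lemma partial_deriv_centred_quadratic:
  "partial_deriv i (centred_quadratic w a b c) = (\<lambda>x. b $ i + 2 * c * (x - w) $ i)"
  by (rule ext) (subst partial_deriv_eqI[OF centred_quadratic_has_derivative],
      simp add: inner_axis)

lemma has_derivative_affine_coord:
  fixes w :: "real^'n::finite"
  shows "((\<lambda>x. a + c * (x - w) $ i) has_derivative (\<lambda>h. c * h $ i)) (at x within A)"
  unfolding vector_minus_component
  by (auto intro!: derivative_eq_intros bounded_linear.has_derivative[OF bounded_linear_vec_nth])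

lemma extends_cont_if_continuous_on: "continuous_on S h \<Longrightarrow> extends_cont S h"
  unfolding extends_cont_def by blast

text \<open>Positivity compares members of \<open>C2_on S\<close> only, so the bounding quadratics
  must belong to it. Their first partial derivatives are affine and their second ones
  constant.\<close>

lemma centred_quadratic_in_C2_on: "centred_quadratic w a b c \<in> C2_on S"
proof -
  have 2: "partial_deriv i (\<lambda>x. b $ j + 2 * c * (x - w) $ j) = (\<lambda>x. 2 * c * axis i 1 $ j)" for i j
    by (rule ext) (rule partial_deriv_eqI[OF has_derivative_affine_coord])
  have "centred_quadratic w a b c differentiable_on A"
    "(\<lambda>x. b $ j + 2 * c * (x - w) $ j) differentiable_on A" for A j
    unfolding differentiable_on_def differentiable_def
    using centred_quadratic_has_derivative has_derivative_affine_coord by blast+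
  then show ?thesis
    unfolding C2_on_def mem_Collect_eq partial_deriv_centred_quadratic 2
    by (simp add: extends_cont_if_continuous_on differentiable_imp_continuous_on)
qed

subsection \<open>The norm of the second differential\<close>

text \<open>Coordinates of a unit vector are at most 1 in absolute value. The bound is crude, but it
  only has to show that suprema are taken over bounded sets.\<close>

lemma abs_quad_form_le_sum:
  fixes a :: "'n::finite \<Rightarrow> 'n \<Rightarrow> real" and v :: "real^'n"
  assumes "\<And>i j. \<bar>a i j\<bar> \<le> B i j" "norm v = 1"
  shows "\<bar>\<Sum>i\<in>UNIV. \<Sum>j\<in>UNIV. a i j * v $ i * v $ j\<bar> \<le> (\<Sum>i\<in>UNIV. \<Sum>j\<in>UNIV. B i j)"
proof -
  have v: "\<bar>v $ i\<bar> \<le> 1" for i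
    using component_le_norm_cart[of v i] assms(2) by simp
  have "\<bar>a i j * v $ i * v $ j\<bar> \<le> B i j" for i j
  proof -
    have "\<bar>a i j\<bar> * \<bar>v $ i\<bar> * \<bar>v $ j\<bar> \<le> B i j * 1 * 1"
      by (intro mult_mono assms v) (auto intro: order_trans[OF abs_ge_zero assms(1)])
    then show ?thesis
      by (simp add: abs_mult)
  qed
  then have "(\<Sum>i\<in>UNIV. \<Sum>j\<in>UNIV. \<bar>a i j * v $ i * v $ j\<bar>) \<le> (\<Sum>i\<in>UNIV. \<Sum>j\<in>UNIV. B i j)"
    by (intro sum_mono)
  moreover have "\<bar>\<Sum>i\<in>UNIV. \<Sum>j\<in>UNIV. a i j * v $ i * v $ j\<bar>
      \<le> (\<Sum>i\<in>UNIV. \<Sum>j\<in>UNIV. \<bar>a i j * v $ i * v $ j\<bar>)"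
    by (intro order_trans[OF sum_abs] sum_mono sum_abs)
  ultimately show ?thesis
    by linarith
qed

lemma d2_scaleR: "d2 S f u (r *\<^sub>R v) = r\<^sup>2 * d2 S f u v"
  unfolding d2_def by (simp add: sum_distrib_left power2_eq_square mult_ac)

text \<open>Makes every boundary point a limit of interior points, so that statements about the
  interior pass to \<open>S\<close> by continuity.\<close>

lemma convex_compact_closure_interior:
  fixes S :: "'a::euclidean_space set"
  assumes "convex S" "compact S" "interior S \<noteq> {}"
  shows "closure (interior S) = S"
  using convex_closure_interior[OF assms(1,3)] assms(2) by (simp add: compact_imp_closed)

context
  fixes S :: "(real^'n::finite) set" and f :: "real^'n \<Rightarrow> real"
  assumes convex: "convex S" and compact: "compact S" and nonempty: "interior S \<noteq> {}"
    and f: "f \<in> C2_on S"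
begin

lemmas closure_interior_eq = convex_compact_closure_interior[OF convex compact nonempty]

lemma partial_deriv2_extension:
  obtains g where "continuous_on S g"
    "\<And>u. u \<in> S \<Longrightarrow> partial_deriv2 S i j f u = g u"
    "\<And>u. u \<in> interior S \<Longrightarrow> partial_deriv i (partial_deriv j f) u = g u"
proof -
  obtain g where g: "continuous_on S g"
    "\<And>u. u \<in> interior S \<Longrightarrow> g u = partial_deriv i (partial_deriv j f) u"
    using f unfolding C2_on_def extends_cont_def by blast
  have "partial_deriv2 S i j f u = g u" if "u \<in> S" for u
    unfolding partial_deriv2_def
  proof (rule tendsto_Lim)
    \<comment> \<open>In a space without isolated points, each point in the closure of an open set
      is a limit point of that set. Hence the limit is unique.\<close>
    have "u islimpt interior S"
      using islimpt_closure_open[OF open_interior closure_interior_eq[symmetric] that]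
        closure_interior_eq by (metis limpt_of_closure)
    then show "\<not> trivial_limit (at u within interior S)"
      by (simp add: trivial_limit_within)
    have "(g \<longlongrightarrow> g u) (at u within interior S)"
      using g(1) that tendsto_within_subset[OF _ interior_subset]
      unfolding continuous_on_def by blast
    then show "(partial_deriv i (partial_deriv j f) \<longlongrightarrow> g u) (at u within interior S)"
      by (rule Lim_transform_eventually) (auto simp: eventually_at_filter g(2))
  qed
  with g that show thesis by metis
qed

lemma partial_deriv2_interior:
  "u \<in> interior S \<Longrightarrow> partial_deriv2 S i j f u = partial_deriv i (partial_deriv j f) u"
  by (metis partial_deriv2_extension interior_subset subsetD)

text \<open>The continuous extensions of the second partial derivatives are bounded on the compact
  set \<open>S\<close>, which yields one \<open>K\<close> for all base points and
  directions.\<close>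

lemma d2_bounded:
  obtains K where "\<And>u v. u \<in> S \<Longrightarrow> norm v = 1 \<Longrightarrow> \<bar>d2 S f u v\<bar> \<le> K"
proof -
  have "\<exists>B. \<forall>u\<in>S. \<bar>partial_deriv2 S i j f u\<bar> \<le> B" for i j
  proof -
    obtain g where g: "continuous_on S g" "\<And>u. u \<in> S \<Longrightarrow> partial_deriv2 S i j f u = g u"
      using partial_deriv2_extension by blast
    have "bounded (g ` S)"
      using compact_continuous_image[OF g(1) compact] by (rule compact_imp_bounded)
    then show ?thesis
      using g(2) by (auto simp: bounded_iff)
  qed
  then obtain B where "\<And>i j u. u \<in> S \<Longrightarrow> \<bar>partial_deriv2 S i j f u\<bar> \<le> B i j"
    by metis
  then show thesis
    unfolding d2_def by (intro that[of "\<Sum>i\<in>UNIV. \<Sum>j\<in>UNIV. B i j", unfolded d2_def] abs_quad_form_le_sum)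
qed

text \<open>Both sides scale quadratically in \<open>v\<close>, which reduces the claim to a unit
  vector; there the two nested suprema apply.\<close>

lemma d2_le_d2_sup_norm:
  assumes "u \<in> S"
  shows "\<bar>d2 S f u v\<bar> \<le> d2_sup_norm S f * (norm v)\<^sup>2"
proof (cases "v = 0")
  case True
  then show ?thesis by (simp add: d2_def)
next
  case False
  obtain K where K: "\<And>u v. u \<in> S \<Longrightarrow> norm v = 1 \<Longrightarrow> \<bar>d2 S f u v\<bar> \<le> K"
    using d2_bounded by blast
  \<comment> \<open>\<open>cSUP_least\<close> requires a nonempty index set.\<close>
  have unit: "\<exists>v :: real^'n. norm v = 1"
    using norm_axis_1 by blast
  have "quad_form_norm (d2 S f u) \<le> K" if "u \<in> S" for u
    unfolding quad_form_norm_def using K[OF that] unit by (intro cSUP_least) auto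
  then have bdd: "bdd_above ((\<lambda>u. quad_form_norm (d2 S f u)) ` S)"
    by (rule bdd_aboveI2)
  define e where "e = v /\<^sub>R norm v"
  have e: "norm e = 1" "v = norm v *\<^sub>R e"
    using False by (simp_all add: e_def)
  have "\<bar>d2 S f u e\<bar> \<le> quad_form_norm (d2 S f u)"
    unfolding quad_form_norm_def
    using e(1) K[OF assms] by (intro cSUP_upper bdd_aboveI2) auto
  also have "\<dots> \<le> d2_sup_norm S f"
    unfolding d2_sup_norm_def by (rule cSUP_upper[OF assms bdd])
  finally have "(norm v)\<^sup>2 * \<bar>d2 S f u e\<bar> \<le> (norm v)\<^sup>2 * d2_sup_norm S f"
    by (rule mult_left_mono) simp
  then show ?thesis
    by (subst e(2), subst d2_scaleR) (simp add: abs_mult mult.commute)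
qed

subsection \<open>Taylor estimate\<close>

text \<open>One-dimensional Taylor formula with Lagrange remainder on the segment from
  \<open>w\<close> to \<open>x\<close>, which convexity keeps inside the interior.\<close>

lemma Taylor_interior:
  assumes w: "w \<in> interior S" and x: "x \<in> interior S"
  shows "\<bar>f x - f w - (\<chi> i. partial_deriv i f w) \<bullet> (x - w)\<bar>
    \<le> d2_sup_norm S f / 2 * (norm (x - w))\<^sup>2"
proof -
  define v where "v = x - w"
  \<comment> \<open>For \<open>m\<close> = 0, 1, 2 this is the derivative of order \<open>m\<close>
    of \<open>f\<close> along the segment.\<close>
  define diff where "diff m t = (if m = 0 then f (w + t *\<^sub>R v)
     else if m = 1 then \<Sum>j\<in>UNIV. partial_deriv j f (w + t *\<^sub>R v) * v $ j
     else d2 S f (w + t *\<^sub>R v) v)" for m :: nat and t :: real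
  have line: "w + t *\<^sub>R v \<in> interior S" if "0 \<le> t" "t \<le> 1" for t
  proof -
    have "(1 - t) *\<^sub>R w + t *\<^sub>R x \<in> interior S"
      using convex_interior[OF convex] w x that by (simp add: convex_alt)
    then show ?thesis by (simp add: v_def algebra_simps)
  qed
  have differentiable: "f differentiable at u" "partial_deriv j f differentiable at u"
    if "u \<in> interior S" for u j
    using f that unfolding C2_on_def
    by (auto simp: differentiable_on_eq_differentiable_at[OF open_interior])
  have "(diff 0 has_real_derivative diff 1 t) (at t)"
    if "0 \<le> t" "t \<le> 1" for t
    using DERIV_along_line[OF differentiable(1)[OF line[OF that]]]
    by (simp add: diff_def[abs_def])
  moreover have "(diff 1 has_real_derivative diff 2 t) (at t)"
    if "0 \<le> t" "t \<le> 1" for t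
  proof -
    have "((\<lambda>t. \<Sum>j\<in>UNIV. partial_deriv j f (w + t *\<^sub>R v) * v $ j) has_real_derivative
      (\<Sum>j\<in>UNIV. (\<Sum>i\<in>UNIV. partial_deriv i (partial_deriv j f) (w + t *\<^sub>R v) * v $ i) * v $ j)) (at t)"
      by (intro DERIV_sum DERIV_cmult_right DERIV_along_line differentiable(2) line that)
    \<comment> \<open>In \<open>d2\<close> the index of the outer differentiation is the outer
      summation index, hence the exchange of sums.\<close>
    also have "(\<Sum>j\<in>UNIV. (\<Sum>i\<in>UNIV. partial_deriv i (partial_deriv j f) (w + t *\<^sub>R v) * v $ i) * v $ j)
      = d2 S f (w + t *\<^sub>R v) v"
      unfolding d2_def partial_deriv2_interior[OF line[OF that]] sum_distrib_right
      by (rule sum.swap)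
    finally show ?thesis
      by (simp add: diff_def[abs_def])
  qed
  ultimately have "\<forall>m t. m < 2 \<and> 0 \<le> t \<and> t \<le> 1 \<longrightarrow> DERIV (diff m) t :> diff (Suc m) t"
    by (simp only: less_2_cases_iff) (metis One_nat_def Suc_1)
  then obtain t where t: "0 < t" "t < 1"
    "diff 0 1 = (\<Sum>m<2. diff m 0 / fact m * (1 - 0) ^ m) + diff 2 t / fact 2 * (1 - 0)\<^sup>2"
    using Taylor_up[of 2 diff "diff 0" 0 1 0] by auto
  have "diff 0 1 = diff 0 0 + diff 1 0 + diff 2 t / 2"
    using t(3) by (simp add: numeral_2_eq_2)
  then have "f x = f w + (\<chi> i. partial_deriv i f w) \<bullet> v + d2 S f (w + t *\<^sub>R v) v / 2"
    by (simp add: diff_def v_def inner_vec_def)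
  moreover have "\<bar>d2 S f (w + t *\<^sub>R v) v\<bar> \<le> d2_sup_norm S f * (norm v)\<^sup>2"
    using line[of t] t interior_subset by (intro d2_le_d2_sup_norm) auto
  ultimately show ?thesis
    unfolding v_def abs_le_iff by linarith
qed

text \<open>At boundary points \<open>partial_deriv\<close> would depend on values outside
  \<open>S\<close>, so the estimate is carried there by continuity in \<open>x\<close>; derivatives
  of \<open>f\<close> occur only at the interior point \<open>w\<close>.\<close>

lemma Taylor_bound:
  assumes w: "w \<in> interior S" and x: "x \<in> S"
  shows "\<bar>f x - f w - (\<chi> i. partial_deriv i f w) \<bullet> (x - w)\<bar>
    \<le> d2_sup_norm S f / 2 * (norm (x - w))\<^sup>2"
proof -
  let ?E = "\<lambda>x. \<bar>f x - f w - (\<chi> i. partial_deriv i f w) \<bullet> (x - w)\<bar>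
      - d2_sup_norm S f / 2 * (norm (x - w))\<^sup>2"
  have "continuous_on S f"
    using f by (simp add: C2_on_def)
  then have "continuous_on (closure (interior S)) ?E"
    unfolding closure_interior_eq by (intro continuous_intros)
  moreover have "x \<in> closure (interior S)"
    using x by (simp only: closure_interior_eq)
  ultimately have "?E x \<le> 0"
  proof (rule continuous_le_on_closure)
    show "?E y \<le> 0" if "y \<in> interior S" for y
      using Taylor_interior[OF w that] by linarith
  qed
  then show ?thesis by linarith
qed

section \<open>Comparison of the functional with the integral\<close>

lemma positive_functional_integral_diff_bound:
  assumes w: "w \<in> interior S"
    and T: "positive_linear_functional S (C2_on S) T"
    and exact: "\<And>q. q \<in> polys_deg_le 2 \<Longrightarrow> T q = integral S q"
  shows "\<bar>integral S f - T f\<bar> \<le> d2_sup_norm S f * integral S (\<lambda>x. (norm (x - w))\<^sup>2)"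
proof -
  have integrable: "h integrable_on S" if "continuous_on S h" for h :: "real^'n \<Rightarrow> real"
    using borel_integrable_compact[OF compact that]
    by (intro set_borel_integral_eq_integral(1)) (simp add: set_integrable_def)
  \<comment> \<open>The sign \<open>s = 1\<close> gives the upper bound and \<open>s = -1\<close>
    the lower one.\<close>
  define P where "P s = centred_quadratic w (f w) (\<chi> i. partial_deriv i f w) (s * (d2_sup_norm S f / 2))"
    for s :: real
  have cont: "continuous_on S f" "continuous_on S (P s)" for s
    using f centred_quadratic_in_C2_on[of w _ _ _ S] by (auto simp: C2_on_def P_def)
  have le: "P (-1) x \<le> f x" "f x \<le> P 1 x" if "x \<in> S" for x
    using Taylor_bound[OF w that]
    by (simp_all only: P_def centred_quadratic_def abs_le_iff) linarith+
  have "T (P (-1)) \<le> T f" "T f \<le> T (P 1)"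
    using T f le centred_quadratic_in_C2_on
    unfolding positive_linear_functional_def P_def by blast+
  moreover have "T (P s) = integral S (P s)" for s
    unfolding P_def by (intro exact centred_quadratic_in_polys_deg_le)
  moreover have "integral S (P (-1)) \<le> integral S f" "integral S f \<le> integral S (P 1)"
    using le by (auto intro!: integral_le integrable cont)
  ultimately have "\<bar>integral S f - T f\<bar> \<le> integral S (P 1) - integral S (P (-1))"
    by simp
  also have "\<dots> = integral S (\<lambda>x. P 1 x - P (-1) x)"
    by (intro integral_diff[symmetric] integrable cont)
  \<comment> \<open>The affine parts cancel and the two halves of the norm add up.\<close>
  also have "\<dots> = d2_sup_norm S f * integral S (\<lambda>x. (norm (x - w))\<^sup>2)"
    by (simp add: P_def centred_quadratic_def field_simps)
  finally show ?thesis .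
qed

end

text \<open>Interior points of a full-dimensional simplex are those with strictly positive
  barycentric coordinates summing to 1; here all are equal. Injectivity ensures that there are
  \<open>DIM('a) + 1\<close> vertices.\<close>

lemma barycenter_in_interior:
  fixes p :: "nat \<Rightarrow> 'a::euclidean_space"
  assumes "inj_on p {..DIM('a)}" "\<not> affine_dependent (p ` {..DIM('a)})"
  shows "(1 / (real DIM('a) + 1)) *\<^sub>R (\<Sum>i\<le>DIM('a). p i) \<in> interior (convex hull (p ` {..DIM('a)}))"
  unfolding interior_convex_hull_explicit_minimal[OF assms(2)] card_image[OF assms(1)]
  by (auto simp: sum.reindex[OF assms(1)] scaleR_sum_right card_image[OF assms(1)]
      intro!: exI[of _ "\<lambda>_. 1 / (real DIM('a) + 1)"])

theorem theorem7:
  fixes p :: "nat \<Rightarrow> real^'n::finite"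
    and S :: "(real^'n) set"
    and pbar :: "real^'n"
    and T :: "(real^'n \<Rightarrow> real) \<Rightarrow> real"
    and f :: "real^'n \<Rightarrow> real"
  assumes "inj_on p {..CARD('n)}"
    and "\<not> affine_dependent (p ` {..CARD('n)})"
    and "S = convex hull (p ` {..CARD('n)})"
    and "pbar = (1 / (real CARD('n) + 1)) *\<^sub>R (\<Sum>i\<le>CARD('n). p i)"
    and "positive_linear_functional S (C2_on S) T"
    and "\<And>q. q \<in> polys_deg_le 2 \<Longrightarrow> T q = integral S q"
    and "f \<in> C2_on S"
  shows "\<bar>integral S f - T f\<bar> \<le> d2_sup_norm S f * integral S (\<lambda>x. (norm (x - pbar))\<^sup>2)"
proof -
  have pbar: "pbar \<in> interior S"
    using barycenter_in_interior[of p] assms(1,2) by (simp add: assms(3,4))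
  moreover have "convex S" "compact S"
    by (simp_all add: assms(3) finite_imp_compact_convex_hull)
  ultimately show ?thesis
    using assms(5-7) by (intro positive_functional_integral_diff_bound) auto
qed

end
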